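(* Let $(a_n)_{n\ge1}$ be a non-periodic E-sequence such that $\limsup_{n\to\infty}\frac{b_n}{n}>\log_2 3$, where $b_n=\sum_{i=1}^n a_i$. Then $(a_n)$ is $\Omega$-divergent.
   Context: An E-sequence is any infinite sequence $(a_n)_{n\ge1}$ of positive integers. For an odd positive integer $x$, its trajectory $(x_n)_{n\ge0}$ and its E-sequence $(a_n)_{n\ge1}$ are defined by $x_0=x$ and, for $n\ge1$, $x_n=\frac{3x_{n-1}+1}{2^{a_n}}$, where $a_n$ is the exponent of the largest power of $2$ dividing $3x_{n-1}+1$. An E-sequence is $\Omega$-divergent if it is not the E-sequence of any odd positive integer. An E-sequence is periodic if there are integers $l\ge0$, $r\ge1$ with $a_n=a_{n+r}$ for all $n>l$; otherwise it is non-periodic. *)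

theory Defs
  imports "HOL-Analysis.Analysis" "HOL-Computational_Algebra.Primes"
begin

text \<open>
  A sequence $(a_n)_{n \ge 1}$ is represented by a function on \<^typ>\<open>nat\<close> whose value at \<open>0\<close>
  is irrelevant: every notion below inspects only the indices \<open>n \<ge> 1\<close>.
\<close>

definition E_sequence :: "(nat \<Rightarrow> nat) \<Rightarrow> bool" where
  "E_sequence a \<longleftrightarrow> (\<forall>n\<ge>1. a n > 0)"

text \<open>The division is exact, see \<open>collatz_traj_Suc_mult\<close> below.\<close>

fun collatz_traj :: "nat \<Rightarrow> nat \<Rightarrow> nat" where
  "collatz_traj x 0 = x"
| "collatz_traj x (Suc n) =
     (3 * collatz_traj x n + 1) div 2 ^ multiplicity 2 (3 * collatz_traj x n + 1)"

definition E_seq_of :: "nat \<Rightarrow> nat \<Rightarrow> nat" where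
  "E_seq_of x n = multiplicity 2 (3 * collatz_traj x (n - 1) + 1)"

lemma collatz_traj_Suc_mult:
  "2 ^ E_seq_of x (Suc n) * collatz_traj x (Suc n) = 3 * collatz_traj x n + 1"
  unfolding E_seq_of_def collatz_traj.simps diff_Suc_1
  by (rule dvd_mult_div_cancel[OF multiplicity_dvd])

definition Omega_divergent :: "(nat \<Rightarrow> nat) \<Rightarrow> bool" where
  "Omega_divergent a \<longleftrightarrow>
     E_sequence a \<and> \<not> (\<exists>x. x > 0 \<and> odd x \<and> (\<forall>n\<ge>1. a n = E_seq_of x n))"

definition periodic_seq :: "(nat \<Rightarrow> nat) \<Rightarrow> bool" where
  "periodic_seq a \<longleftrightarrow> (\<exists>l r. r \<ge> 1 \<and> (\<forall>n>l. a n = a (n + r)))"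

end

theory Submission
  imports Defs "HOL-Real_Asymp.Real_Asymp"
begin

text \<open>
  If \<open>a\<close> is the E-sequence of \<open>x\<close> and is non-periodic, then the trajectory of \<open>x\<close> never repeats a
  value. Multiplying the relations \<open>2 ^ a\<^sub>i * x\<^sub>i = 3 * x\<^sub>i\<^sub>-\<^sub>1 + 1\<close> gives
  \<open>2 ^ b\<^sub>n * x\<^sub>n = 3 ^ n * x * (\<Prod>i<n. 1 + 1 / (3 * x\<^sub>i))\<close>, and since the \<open>x\<^sub>i\<close> are distinct positive
  integers the last product is at most \<open>\<Prod>k=1..n. 1 + 1 / k = n + 1\<close>. Hence
  \<open>b\<^sub>n \<le> n * log 2 3 + O(log n)\<close>, contradicting the assumption on the limsup.
\<close>

text \<open>The extremal case is \<open>{1..n}\<close>, where the product telescopes to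
  \<open>n + 1\<close>. Elements are added in increasing order: a new maximum \<open>m\<close> of a
  set of positive integers is at least the new cardinality, so its factor raises the bound by at
  most 1.\<close>

lemma prod_one_plus_inverse_le_Suc_card:
  fixes S :: "nat set"
  assumes "finite S" "0 \<notin> S"
  shows "(\<Prod>y\<in>S. 1 + 1 / real y) \<le> real (Suc (card S))"
  using assms
proof (induction S rule: finite_linorder_max_induct)
  case empty
  then show ?case by simp
next
  case (insert m S)
  have "insert m S \<subseteq> {1..m}"
  proof
    fix y assume "y \<in> insert m S"
    then have "y \<noteq> 0" "y \<le> m"
      using insert.hyps insert.prems by (metis, auto)
    then show "y \<in> {1..m}" by simp
  qed
  then have "card (insert m S) \<le> m"
    using card_mono[of "{1..m}" "insert m S"] by simp
  moreover have "m \<notin> S"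
    using insert.hyps by auto
  ultimately have card_lt: "Suc (card S) \<le> m"
    using insert.hyps by simp
  have "(\<Prod>y\<in>insert m S. 1 + 1 / real y) = (1 + 1 / real m) * (\<Prod>y\<in>S. 1 + 1 / real y)"
    using insert.hyps \<open>m \<notin> S\<close> by simp
  also have "\<dots> \<le> (1 + 1 / real m) * real (Suc (card S))"
    using insert by (intro mult_left_mono) auto
  also have "\<dots> = real (Suc (card S)) + real (Suc (card S)) / real m"
    by (simp add: algebra_simps add_divide_distrib)
  also have "\<dots> \<le> real (Suc (card S)) + 1"
    using card_lt by (intro add_left_mono) (simp add: divide_le_eq)
  finally show ?case
    using insert.hyps \<open>m \<notin> S\<close> by simp
qed

lemma collatz_traj_pos:
  assumes "x > 0"
  shows "collatz_traj x n > 0"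
proof (cases n)
  case (Suc m)
  have "collatz_traj x (Suc m) \<noteq> 0"
    using collatz_traj_Suc_mult[of x m] by (metis add_is_0 mult_0_right one_neq_zero)
  then show ?thesis using Suc by simp
qed (use assms in simp)

lemma collatz_traj_eq_shift:
  assumes "collatz_traj x m = collatz_traj x n"
  shows "collatz_traj x (m + k) = collatz_traj x (n + k)"
  using assms by (induction k) auto

text \<open>Each trajectory value determines all later ones, so a repetition makes the exponents
  cycle with preperiod \<open>m\<close> and period \<open>n - m\<close>.\<close>

lemma periodic_E_seq_of_if_traj_repeats:
  assumes "m < n" "collatz_traj x m = collatz_traj x n"
  shows "periodic_seq (E_seq_of x)"
  unfolding periodic_seq_def
proof (intro exI conjI allI impI)
  show "n - m \<ge> 1" using assms by simp
  fix j assume "j > m"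
  then obtain k where "j = Suc (m + k)"
    using less_imp_Suc_add by blast
  then show "E_seq_of x j = E_seq_of x (j + (n - m))"
    using collatz_traj_eq_shift[OF assms(2), of k] assms(1) by (simp add: E_seq_of_def add.commute)
qed

lemma two_power_sum_E_seq_of:
  assumes "x > 0"
  shows "2 ^ (\<Sum>i=1..n. E_seq_of x i) * real (collatz_traj x n)
           = 3 ^ n * real x * (\<Prod>i<n. 1 + 1 / (3 * real (collatz_traj x i)))"
proof (induction n)
  case (Suc n)
  let ?c = "real (collatz_traj x n)"
  have "2 ^ E_seq_of x (Suc n) * real (collatz_traj x (Suc n)) = 3 * ?c + 1"
    using arg_cong[OF collatz_traj_Suc_mult[of x n], of real]
    by (simp del: collatz_traj.simps)
  also have "\<dots> = ?c * (3 * (1 + 1 / (3 * ?c)))"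
    using collatz_traj_pos[OF assms, of n] by (simp add: field_simps)
  finally have "2 ^ (\<Sum>i=1..Suc n. E_seq_of x i) * real (collatz_traj x (Suc n))
      = (2 ^ (\<Sum>i=1..n. E_seq_of x i) * ?c) * (3 * (1 + 1 / (3 * ?c)))"
    by (simp add: power_add mult.assoc del: collatz_traj.simps)
  then show ?case
    unfolding Suc.IH by (simp add: mult_ac del: collatz_traj.simps)
qed simp

lemma two_power_sum_E_seq_of_le:
  assumes "x > 0" "inj (collatz_traj x)"
  shows "2 ^ (\<Sum>i=1..n. E_seq_of x i) \<le> 3 ^ n * real x * real (Suc n)"
proof -
  let ?c = "\<lambda>i. real (collatz_traj x i)"
  have pos: "?c i \<ge> 1" for i
    using collatz_traj_pos[OF assms(1), of i] by simp
  have inj: "inj_on (collatz_traj x) {..<n}"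
    using assms(2) inj_on_subset by blast
  \<comment> \<open>Dropping the 3 weakens the bound, but it stays linear in \<open>n\<close>, and
    any polynomial factor vanishes after taking logarithms and dividing by \<open>n\<close>.\<close>
  have "(\<Prod>i<n. 1 + 1 / (3 * ?c i)) \<le> (\<Prod>i<n. 1 + 1 / ?c i)"
  proof (intro prod_mono conjI)
    fix i
    show "1 + 1 / (3 * ?c i) \<le> 1 + 1 / ?c i"
      using pos[of i] by (intro add_left_mono divide_left_mono) auto
  qed simp
  \<comment> \<open>Injectivity turns the product over indices into one over a set of
    \<open>n\<close> distinct positive integers.\<close>
  also have "\<dots> = (\<Prod>y\<in>collatz_traj x ` {..<n}. 1 + 1 / real y)"
    using inj by (simp add: prod.reindex)
  also have "\<dots> \<le> real (Suc (card (collatz_traj x ` {..<n})))"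
    using collatz_traj_pos[OF assms(1)]
    by (intro prod_one_plus_inverse_le_Suc_card) (auto simp: image_iff)
  also have "\<dots> = real (Suc n)"
    using inj by (simp add: card_image)
  finally have "3 ^ n * real x * (\<Prod>i<n. 1 + 1 / (3 * ?c i)) \<le> 3 ^ n * real x * real (Suc n)"
    by (intro mult_left_mono) auto
  moreover have "2 ^ (\<Sum>i=1..n. E_seq_of x i) * 1 \<le> 2 ^ (\<Sum>i=1..n. E_seq_of x i) * ?c n"
    using pos by (intro mult_left_mono) auto
  ultimately show ?thesis
    using two_power_sum_E_seq_of[OF assms(1), of n] by linarith
qed

lemma limsup_mean_E_seq_of_le:
  assumes "x > 0" "inj (collatz_traj x)"
  shows "limsup (\<lambda>n. ereal (real (\<Sum>i=1..n. E_seq_of x i) / real n)) \<le> ereal (log 2 3)"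
proof -
  \<comment> \<open>This is the base-2 logarithm of the preceding bound, divided by
    \<open>n\<close>; the error term is O(log n / n).\<close>
  define u where "u n = log 2 3 + (log 2 (real x) + log 2 (real n + 1)) / real n" for n :: nat
  have "real (\<Sum>i=1..n. E_seq_of x i) / real n \<le> u n" if "n > 0" for n
  proof -
    let ?B = "\<Sum>i=1..n. E_seq_of x i"
    have "real ?B = log 2 (2 ^ ?B)"
      by (simp del: of_nat_sum)
    also have "\<dots> \<le> log 2 (3 ^ n * real x * real (Suc n))"
      using two_power_sum_E_seq_of_le[OF assms, of n] assms(1) by (subst log_le_cancel_iff) auto
    also have "\<dots> = real n * log 2 3 + log 2 (real x) + log 2 (real n + 1)"
      using assms(1) by (simp add: log_mult log_nat_power add.commute)
    finally show ?thesis
      using that by (simp add: u_def field_simps del: of_nat_sum)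
  qed
  then have "limsup (\<lambda>n. ereal (real (\<Sum>i=1..n. E_seq_of x i) / real n)) \<le> limsup (\<lambda>n. ereal (u n))"
    by (intro Limsup_mono eventually_mono[OF eventually_gt_at_top[of 0]]) (simp del: of_nat_sum)
  also have "u \<longlonglongrightarrow> log 2 3"
    unfolding u_def by (real_asymp simp: log_def)
  then have "limsup (\<lambda>n. ereal (u n)) = ereal (log 2 3)"
    by (intro lim_imp_Limsup) auto
  finally show ?thesis .
qed

theorem theorem4p2:
  fixes a b :: "nat \<Rightarrow> nat"
  assumes "E_sequence a"
    and "\<not> periodic_seq a"
    and "\<And>n. b n = (\<Sum>i=1..n. a i)"
    and "limsup (\<lambda>n. ereal (real (b n) / real n)) > ereal (log 2 3)"
  shows "Omega_divergent a"
  unfolding Omega_divergent_def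
proof (intro conjI notI)
  assume "\<exists>x. x > 0 \<and> odd x \<and> (\<forall>n\<ge>1. a n = E_seq_of x n)"
  then obtain x where x: "x > 0" "\<forall>n\<ge>1. a n = E_seq_of x n"
    by blast
  have "\<not> periodic_seq (E_seq_of x)"
  proof
    assume "periodic_seq (E_seq_of x)"
    \<comment> \<open>The sequences are only known to agree from index 1 on, which suffices because
      periodicity inspects only indices above \<open>l\<close>.\<close>
    then have "periodic_seq a"
      using x(2) unfolding periodic_seq_def
      by (metis One_nat_def Suc_leI gr_implies_not0 neq0_conv trans_le_add1)
    then show False using assms(2) by contradiction
  qed
  then have "inj (collatz_traj x)"
    by (intro linorder_injI) (use periodic_E_seq_of_if_traj_repeats in blast)
  moreover have "b n = (\<Sum>i=1..n. E_seq_of x i)" for n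
    unfolding assms(3) using x(2) by (intro sum.cong) auto
  ultimately show False
    using limsup_mean_E_seq_of_le[OF x(1)] assms(4) by simp
qed (fact assms(1))

end
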